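(* Let $\sigma>0$, $T_w>0$, $\hat\rho\in\mathbb{R}$ and a grid code threshold $(\delta\omega_{gc},\delta V_{gc})$ be fixed. The following three design objectives are simultaneously achieved by choosing the filter bandwidths $\omega_f>0$ and $\omega_v>0$ as large as possible, subject to inner-loop stability and grid code constraints: (i) Maximum Fenichel gap: maximise $\mathcal{P}_F=\frac{\omega_f+\omega_v}{2}-\hat\rho$, which is linear and increasing in both $\omega_f$ and $\omega_v$. (ii) Minimum null covariance: minimise $\mathrm{tr}(\boldsymbol{\Sigma}_{\mathrm{long}})=\sigma^2\left(\frac1{\omega_f^2}+\frac1{\omega_v^2}\right)$, which is strictly decreasing in both $\omega_f$ and $\omega_v$. (iii) Minimum $p$-value at the grid code threshold: minimise $$\exp\!\left(-\frac{T_w}{2\sigma^2}\left[\omega_f^2\,\delta\omega_{gc}^2+\omega_v^2\,\delta V_{gc}^2\right]\right),$$ which is strictly decreasing in both $\omega_f$ and $\omega_v$.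
   Context: $\omega_f,\omega_v$ are the frequency and voltage filter bandwidths of a droop-controlled inverter, $\hat\rho$ is the slow synchronisation rate on the droop manifold, $\sigma$ the noise intensity and $T_w$ the measurement window length. $\boldsymbol{\Sigma}_{\mathrm{long}}$ here is the long-run covariance of the transverse Ornstein--Uhlenbeck process in its leading-order (small droop coupling) form $\boldsymbol{\Sigma}_{\mathrm{long}}=\sigma^2\,\mathrm{diag}(\omega_f^{-2},\omega_v^{-2})$. The $p$-value of an observation $(\delta\omega,\delta V)$ is $\exp(-\mathcal{D}/2)$ with $\mathcal{D}=\frac{T_w}{\sigma^2}[\omega_f^2\delta\omega^2+\omega_v^2\delta V^2]$, i.e. the $\chi^2(2)$ tail probability. "Simultaneously achieved" means that all three objectives are monotone in the same direction (improving) in each of $\omega_f$ and $\omega_v$.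
   Formalization: Both components of the grid code threshold, δω_gc and δV_gc, are assumed nonzero; if one of them is zero, the p-value in (iii) is constant in the corresponding bandwidth and so is not strictly decreasing in it. *)

theory Defs
  imports "HOL-Probability.Probability"
begin

text \<open>
  Conventions: \<open>\<omega>f\<close>, \<open>\<omega>v\<close> are the frequency and voltage filter bandwidths, \<open>\<rho>\<close> is the slow
  synchronisation rate on the droop manifold, \<open>\<sigma>\<close> the noise intensity, \<open>Tw\<close> the length of the
  measurement window.
\<close>

definition fenichel_gap :: "real \<Rightarrow> real \<Rightarrow> real \<Rightarrow> real" where
  "fenichel_gap \<rho> \<omega>f \<omega>v = (\<omega>f + \<omega>v) / 2 - \<rho>"

definition diag_matrix :: "real ^ 'n \<Rightarrow> real ^ 'n ^ 'n" where
  "diag_matrix d = (\<chi> i j. if i = j then d $ i else 0)"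

text \<open>
  Long-run covariance of the transverse Ornstein--Uhlenbeck process, in its leading-order (small
  droop coupling) form. Coordinate 1 is the frequency, coordinate 2 the voltage.
\<close>

definition Sigma_long :: "real \<Rightarrow> real \<Rightarrow> real \<Rightarrow> real ^ 2 ^ 2" where
  "Sigma_long \<sigma> \<omega>f \<omega>v = \<sigma>\<^sup>2 *\<^sub>R diag_matrix (vector [1 / \<omega>f\<^sup>2, 1 / \<omega>v\<^sup>2])"

definition test_statistic :: "real \<Rightarrow> real \<Rightarrow> real \<Rightarrow> real \<Rightarrow> real \<Rightarrow> real \<Rightarrow> real" where
  "test_statistic \<sigma> Tw \<omega>f \<omega>v \<delta>\<omega> \<delta>V = Tw / \<sigma>\<^sup>2 * (\<omega>f\<^sup>2 * \<delta>\<omega>\<^sup>2 + \<omega>v\<^sup>2 * \<delta>V\<^sup>2)"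

definition chi_square_density :: "nat \<Rightarrow> real \<Rightarrow> real" where
  "chi_square_density k x =
     (if 0 < x then x powr (real k / 2 - 1) * exp (- x / 2) / (2 powr (real k / 2) * Gamma (real k / 2))
      else 0)"

definition chi_square :: "nat \<Rightarrow> real measure" where
  "chi_square k = density lborel (\<lambda>x. ennreal (chi_square_density k x))"

text \<open>
  The \<open>p\<close>-value is taken as the upper tail probability of the chi-square law with two degrees of
  freedom, rather than as its closed form \<open>exp (- D / 2)\<close>, with \<open>D\<close> the test statistic.
\<close>

definition p_value :: "real \<Rightarrow> real \<Rightarrow> real \<Rightarrow> real \<Rightarrow> real \<Rightarrow> real \<Rightarrow> real" where
  "p_value \<sigma> Tw \<omega>f \<omega>v \<delta>\<omega> \<delta>V =
     measure (chi_square 2) {test_statistic \<sigma> Tw \<omega>f \<omega>v \<delta>\<omega> \<delta>V..}"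

end

theory Submission
  imports Defs "HOL-Real_Asymp.Real_Asymp"
begin

text \<open>Each objective depends on the two bandwidths through a sum of one-variable terms: the
  gap is affine with slopes 1/2, the trace is a positive multiple of a sum of inverse squares
  (\<open>trace_Sigma_long\<close>), and the \<open>p\<close>-value is \<open>exp\<close> of a
  negative combination of squares (\<open>p_value_eq_exp\<close>). The last form rests on
  \<open>chi_square_2_tail\<close>: with two degrees of freedom the chi-square law is exponential
  with rate 1/2. Monotonicity of squares and inverse squares on the positive axis gives strictness
  in each bandwidth. The weak versions in both bandwidths at once make a componentwise greatest
  feasible point optimal for all three objectives together.\<close>

lemma chi_square_2_tail:
  assumes "0 \<le> t"
  shows "measure (chi_square 2) {t..} = exp (- t / 2)"
proof -
  \<comment> \<open>For \<open>k = 2\<close> the power of \<open>x\<close> has exponent 0 and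
    \<open>Gamma 1 = 1\<close>, which leaves a pure exponential.\<close>
  have dens: "chi_square_density 2 = (\<lambda>x. if 0 < x then exp (- x / 2) / 2 else 0)"
    by (auto simp: fun_eq_iff chi_square_density_def)
  have "emeasure (chi_square 2) {t..}
      = (\<integral>\<^sup>+x. ennreal (chi_square_density 2 x) * indicator {t..} x \<partial>lborel)"
    unfolding chi_square_def by (intro emeasure_density) (simp_all add: dens)
  also have "\<dots> = (\<integral>\<^sup>+x. ennreal (exp (- x / 2) / 2) * indicator {t..} x \<partial>lborel)"
  proof (rule nn_integral_cong_AE) \<comment> \<open>at \<open>0\<close> the chi-square density is \<open>0\<close>, the exponential one \<open>1 / 2\<close>\<close>
    show "AE x in lborel. ennreal (chi_square_density 2 x) * indicator {t..} x
        = ennreal (exp (- x / 2) / 2) * indicator {t..} x"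
      using AE_lborel_singleton[of "0 :: real"]
      by eventually_elim (use assms in \<open>auto simp: dens indicator_def\<close>)
  qed
  also have "\<dots> = ennreal (0 - (- exp (- t / 2)))"
  proof (rule nn_integral_FTC_atLeast)
    show "((\<lambda>x. - exp (- x / 2)) has_real_derivative exp (- x / 2) / 2) (at x)" for x :: real
      by (auto intro!: derivative_eq_intros)
    show "((\<lambda>x::real. - exp (- x / 2)) \<longlongrightarrow> 0) at_top"
      by real_asymp
  qed auto
  finally show ?thesis
    by (simp add: measure_def)
qed

text \<open>\<open>0 \<le> Tw\<close> makes the test statistic nonnegative, the range where the tail
  formula is valid. At \<open>\<sigma> = 0\<close> division by zero yields 0, and both sides equal
  1.\<close>

lemma p_value_eq_exp:
  assumes "0 \<le> Tw"
  shows "p_value \<sigma> Tw a b x y = exp (- (Tw / (2 * \<sigma>\<^sup>2)) * (a\<^sup>2 * x\<^sup>2 + b\<^sup>2 * y\<^sup>2))"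
proof -
  have "0 \<le> test_statistic \<sigma> Tw a b x y"
    using assms by (simp add: test_statistic_def)
  then show ?thesis
    by (simp add: p_value_def chi_square_2_tail test_statistic_def)
qed

lemma trace_Sigma_long: "trace (Sigma_long \<sigma> a b) = \<sigma>\<^sup>2 * (1 / a\<^sup>2 + 1 / b\<^sup>2)"
  by (simp add: trace_def Sigma_long_def diag_matrix_def sum_2 distrib_left)

lemma inverse_square_antimono:
  fixes a b :: real
  assumes "0 < a" "a \<le> b"
  shows "1 / b\<^sup>2 \<le> 1 / a\<^sup>2"
  using assms by (intro divide_left_mono power_mono mult_pos_pos) auto

lemma inverse_square_strict_antimono:
  fixes a b :: real
  assumes "0 < a" "a < b"
  shows "1 / b\<^sup>2 < 1 / a\<^sup>2"
  using assms by (intro divide_strict_left_mono power_strict_mono mult_pos_pos) auto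

text \<open>The gap is affine with constant term \<open>- \<rho>\<close>; subtracting its value at
  the origin leaves the linear part \<open>(a + b) / 2\<close>.\<close>

lemma linear_fenichel_gap: "linear (\<lambda>(a, b). fenichel_gap \<rho> a b - fenichel_gap \<rho> 0 0)"
  by (rule linearI) (auto simp: fenichel_gap_def field_simps)

text \<open>Both bandwidths move at once here, as is needed to compare an arbitrary feasible point
  with the greatest one.\<close>

lemma trace_Sigma_long_antimono:
  assumes "0 < a" "a \<le> a'" "0 < b" "b \<le> b'"
  shows "trace (Sigma_long \<sigma> a' b') \<le> trace (Sigma_long \<sigma> a b)"
  unfolding trace_Sigma_long
  using assms by (intro mult_left_mono add_mono inverse_square_antimono) auto

text \<open>The summand of the fixed bandwidth \<open>b\<close> is common to both sides, so the
  strict drop of the other inverse square decides, scaled by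
  \<open>\<sigma>\<^sup>2 > 0\<close>.\<close>

lemma trace_Sigma_long_strict_antimono:
  assumes "0 < \<sigma>" "0 < a" "a < a'"
  shows "trace (Sigma_long \<sigma> a' b) < trace (Sigma_long \<sigma> a b)"
    and "trace (Sigma_long \<sigma> b a') < trace (Sigma_long \<sigma> b a)"
  unfolding trace_Sigma_long using inverse_square_strict_antimono[OF assms(2,3)] assms(1)
  by (intro mult_strict_left_mono; simp)+

lemma p_value_antimono:
  assumes "0 \<le> Tw" "0 \<le> a" "a \<le> a'" "0 \<le> b" "b \<le> b'"
  shows "p_value \<sigma> Tw a' b' x y \<le> p_value \<sigma> Tw a b x y"
proof -
  have "a\<^sup>2 * x\<^sup>2 + b\<^sup>2 * y\<^sup>2 \<le> a'\<^sup>2 * x\<^sup>2 + b'\<^sup>2 * y\<^sup>2"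
    using assms by (intro add_mono mult_right_mono power_mono) auto
  then have "Tw / (2 * \<sigma>\<^sup>2) * (a\<^sup>2 * x\<^sup>2 + b\<^sup>2 * y\<^sup>2)
      \<le> Tw / (2 * \<sigma>\<^sup>2) * (a'\<^sup>2 * x\<^sup>2 + b'\<^sup>2 * y\<^sup>2)"
    using assms by (intro mult_left_mono) auto
  then show ?thesis
    unfolding p_value_eq_exp[OF assms(1)] by (simp only: exp_le_cancel_iff mult_minus_left neg_le_iff_le)
qed

text \<open>Strictness comes from \<open>x \<noteq> 0\<close>: if \<open>x = 0\<close>, the term
  \<open>a\<^sup>2 * x\<^sup>2\<close> vanishes and the \<open>p\<close>-value is constant in
  \<open>a\<close>.\<close>

lemma p_value_strict_antimono_left:
  assumes "0 < Tw" "\<sigma> \<noteq> 0" "x \<noteq> 0" "0 \<le> a" "a < a'"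
  shows "p_value \<sigma> Tw a' b x y < p_value \<sigma> Tw a b x y"
proof -
  have "a\<^sup>2 * x\<^sup>2 < a'\<^sup>2 * x\<^sup>2"
    using assms by (intro mult_strict_right_mono power_strict_mono) auto
  then have "Tw / (2 * \<sigma>\<^sup>2) * (a\<^sup>2 * x\<^sup>2 + b\<^sup>2 * y\<^sup>2) < Tw / (2 * \<sigma>\<^sup>2) * (a'\<^sup>2 * x\<^sup>2 + b\<^sup>2 * y\<^sup>2)"
    using assms by (intro mult_strict_left_mono) auto
  then show ?thesis
    unfolding p_value_eq_exp[OF less_imp_le[OF assms(1)]]
    by (simp only: exp_less_cancel_iff mult_minus_left neg_less_iff_less)
qed

text \<open>Swapping frequency and voltage, thresholds included, is a symmetry; it transfers
  strictness from the first bandwidth to the second.\<close>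

lemma p_value_commute: "p_value \<sigma> Tw a b x y = p_value \<sigma> Tw b a y x"
  by (simp add: p_value_def test_statistic_def add.commute)

lemma p_value_strict_antimono_right:
  assumes "0 < Tw" "\<sigma> \<noteq> 0" "y \<noteq> 0" "0 \<le> b" "b < b'"
  shows "p_value \<sigma> Tw a b' x y < p_value \<sigma> Tw a b x y"
  using p_value_strict_antimono_left[OF assms] by (simp only: p_value_commute[of \<sigma> Tw a])

text \<open>The stability and grid code constraints enter as an arbitrary feasible set
  \<open>S\<close> of positive pairs, and "as large as possible" means being the componentwise
  greatest element of \<open>S\<close>. Nonzero threshold components are what keeps the
  \<open>p\<close>-value strictly decreasing in each bandwidth.\<close>

theorem theorem4p1:
  fixes \<sigma> Tw \<rho> \<delta>\<omega>gc \<delta>Vgc :: real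
  assumes "\<sigma> > 0" and "Tw > 0"
    and "\<delta>\<omega>gc \<noteq> 0" and "\<delta>Vgc \<noteq> 0"
  shows
    "(linear (\<lambda>(\<omega>f, \<omega>v). fenichel_gap \<rho> \<omega>f \<omega>v - fenichel_gap \<rho> 0 0)
      \<and> (\<forall>\<omega>v>0. strict_mono_on {0<..} (\<lambda>\<omega>f. fenichel_gap \<rho> \<omega>f \<omega>v))
      \<and> (\<forall>\<omega>f>0. strict_mono_on {0<..} (\<lambda>\<omega>v. fenichel_gap \<rho> \<omega>f \<omega>v)))
     \<and>
     ((\<forall>\<omega>f>0. \<forall>\<omega>v>0. trace (Sigma_long \<sigma> \<omega>f \<omega>v) = \<sigma>\<^sup>2 * (1 / \<omega>f\<^sup>2 + 1 / \<omega>v\<^sup>2))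
      \<and> (\<forall>\<omega>v>0. strict_antimono_on {0<..} (\<lambda>\<omega>f. trace (Sigma_long \<sigma> \<omega>f \<omega>v)))
      \<and> (\<forall>\<omega>f>0. strict_antimono_on {0<..} (\<lambda>\<omega>v. trace (Sigma_long \<sigma> \<omega>f \<omega>v))))
     \<and>
     ((\<forall>\<omega>f>0. \<forall>\<omega>v>0. p_value \<sigma> Tw \<omega>f \<omega>v \<delta>\<omega>gc \<delta>Vgc
          = exp (- (Tw / (2 * \<sigma>\<^sup>2)) * (\<omega>f\<^sup>2 * \<delta>\<omega>gc\<^sup>2 + \<omega>v\<^sup>2 * \<delta>Vgc\<^sup>2)))
      \<and> (\<forall>\<omega>v>0. strict_antimono_on {0<..} (\<lambda>\<omega>f. p_value \<sigma> Tw \<omega>f \<omega>v \<delta>\<omega>gc \<delta>Vgc))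
      \<and> (\<forall>\<omega>f>0. strict_antimono_on {0<..} (\<lambda>\<omega>v. p_value \<sigma> Tw \<omega>f \<omega>v \<delta>\<omega>gc \<delta>Vgc)))
     \<and>
     (\<forall>S \<omega>f \<omega>v. S \<subseteq> {0<..} \<times> {0<..} \<longrightarrow> (\<omega>f, \<omega>v) \<in> S \<longrightarrow> (\<forall>(a, b)\<in>S. a \<le> \<omega>f \<and> b \<le> \<omega>v) \<longrightarrow>
        is_arg_max (\<lambda>(a, b). fenichel_gap \<rho> a b) (\<lambda>x. x \<in> S) (\<omega>f, \<omega>v)
        \<and> is_arg_min (\<lambda>(a, b). trace (Sigma_long \<sigma> a b)) (\<lambda>x. x \<in> S) (\<omega>f, \<omega>v)
        \<and> is_arg_min (\<lambda>(a, b). p_value \<sigma> Tw a b \<delta>\<omega>gc \<delta>Vgc) (\<lambda>x. x \<in> S) (\<omega>f, \<omega>v))"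
proof (intro conjI allI impI)
  show "linear (\<lambda>(\<omega>f, \<omega>v). fenichel_gap \<rho> \<omega>f \<omega>v - fenichel_gap \<rho> 0 0)"
    by (rule linear_fenichel_gap)
next
  fix b :: real
  show "strict_mono_on {0<..} (\<lambda>a. fenichel_gap \<rho> a b)"
    and "strict_mono_on {0<..} (\<lambda>a. fenichel_gap \<rho> b a)"
    by (auto simp: monotone_on_def fenichel_gap_def)
  show "strict_antimono_on {0<..} (\<lambda>a. trace (Sigma_long \<sigma> a b))"
    and "strict_antimono_on {0<..} (\<lambda>a. trace (Sigma_long \<sigma> b a))"
    by (rule monotone_onI, simp only: greaterThan_iff trace_Sigma_long_strict_antimono assms)+
  show "strict_antimono_on {0<..} (\<lambda>a. p_value \<sigma> Tw a b \<delta>\<omega>gc \<delta>Vgc)"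
    by (rule monotone_onI) (use assms in \<open>simp add: p_value_strict_antimono_left\<close>)
  show "strict_antimono_on {0<..} (\<lambda>a. p_value \<sigma> Tw b a \<delta>\<omega>gc \<delta>Vgc)"
    by (rule monotone_onI) (use assms in \<open>simp add: p_value_strict_antimono_right\<close>)
next
  fix a b :: real
  show "trace (Sigma_long \<sigma> a b) = \<sigma>\<^sup>2 * (1 / a\<^sup>2 + 1 / b\<^sup>2)"
    by (rule trace_Sigma_long)
  show "p_value \<sigma> Tw a b \<delta>\<omega>gc \<delta>Vgc
      = exp (- (Tw / (2 * \<sigma>\<^sup>2)) * (a\<^sup>2 * \<delta>\<omega>gc\<^sup>2 + b\<^sup>2 * \<delta>Vgc\<^sup>2))"
    using assms by (intro p_value_eq_exp) simp
next
  fix S :: "(real \<times> real) set" and a b :: real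
  assume S: "S \<subseteq> {0<..} \<times> {0<..}" "(a, b) \<in> S" "\<forall>(a', b')\<in>S. a' \<le> a \<and> b' \<le> b"
  \<comment> \<open>Every feasible point lies in the box with opposite corners the origin and
    \<open>(a, b)\<close>, so joint monotonicity compares it with \<open>(a, b)\<close>.\<close>
  have dom: "0 < fst x" "fst x \<le> a" "0 < snd x" "snd x \<le> b" if "x \<in> S" for x
    using S that by (cases x; auto)+
  show "is_arg_max (\<lambda>(a, b). fenichel_gap \<rho> a b) (\<lambda>x. x \<in> S) (a, b)"
  proof -
    have "fenichel_gap \<rho> (fst x) (snd x) \<le> fenichel_gap \<rho> a b" if "x \<in> S" for x
      using dom[OF that] by (simp add: fenichel_gap_def)
    then show ?thesis
      using S(2) by (simp add: is_arg_max_linorder case_prod_beta)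
  qed
  show "is_arg_min (\<lambda>(a, b). trace (Sigma_long \<sigma> a b)) (\<lambda>x. x \<in> S) (a, b)"
    using S(2) by (simp add: is_arg_min_linorder case_prod_beta dom trace_Sigma_long_antimono)
  show "is_arg_min (\<lambda>(a, b). p_value \<sigma> Tw a b \<delta>\<omega>gc \<delta>Vgc) (\<lambda>x. x \<in> S) (a, b)"
    using S(2) assms by (simp add: is_arg_min_linorder case_prod_beta dom p_value_antimono less_imp_le)
qed

end
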